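(* For any integer $k\geq 3$ such that $2k=p^{\alpha}+1\equiv 2\pmod 4$ with $p$ an odd prime and $\alpha$ a non-negative integer, $$v_{\frac{1}{2k-2}}(2,2k-1)=2k-1.$$
   Context: Planes are two-dimensional linear subspaces of Euclidean space $\mathbb{R}^{r}$. Two planes $\Gamma,\Gamma'$ are isoclinic with angle $\phi$ if the angle between a line $l\subset\Gamma$ and a line $m\subset\Gamma'$ has both its stationary values (as $l$ runs through $\Gamma$ and $m$ through $\Gamma'$) equal to $\phi$. Equivalently, with $\lambda=\cos^{2}\phi$: if $A$ is the $2\times 2$ matrix of inner products of the vectors of an orthonormal basis of $\Gamma$ with those of an orthonormal basis of $\Gamma'$, then $AA^{T}=\lambda I_{2}$. An $n$-tuple of planes is equi-isoclinic with parameter $\lambda$ if its members are pairwise isoclinic with the same non-zero angle $\phi$ and $\lambda=\cos^{2}\phi$. $v_{\lambda}(2,r)$ denotes the maximum number of equi-isoclinic planes with parameter $\lambda$ that can be imbedded in $\mathbb{R}^{r}$. *)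

theory Defs
  imports "HOL-Analysis.Analysis" "HOL-Library.Extended_Nat"
begin

definition plane :: "'a::euclidean_space set \<Rightarrow> bool" where
  "plane \<Gamma> \<longleftrightarrow> subspace \<Gamma> \<and> dim \<Gamma> = 2"

definition vec_cos :: "'a::euclidean_space \<Rightarrow> 'a \<Rightarrow> real" where
  "vec_cos u v = (u \<bullet> v) / (norm u * norm v)"

text \<open>The angle in $[0, \pi/2]$ between the lines spanned by the non-zero vectors \<open>u\<close> and \<open>v\<close>.\<close>

definition line_angle :: "'a::euclidean_space \<Rightarrow> 'a \<Rightarrow> real" where
  "line_angle u v = arccos \<bar>vec_cos u v\<bar>"

text \<open>
  Lines are represented by non-zero spanning vectors. The angle itself is not differentiable
  where it equals \<open>0\<close> or \<open>\<pi>/2\<close>, so stationarity is expressed through the cosine \<open>vec_cos\<close>: it is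
  smooth, unchanged up to sign when \<open>u\<close> or \<open>v\<close> is rescaled, and where it is different from
  \<open>0\<close> and \<open>\<plusminus>1\<close> it has the same critical points as the angle.
\<close>

definition stationary_lines ::
  "'a::euclidean_space set \<Rightarrow> 'a set \<Rightarrow> 'a \<Rightarrow> 'a \<Rightarrow> bool" where
  "stationary_lines \<Gamma> \<Gamma>' u v \<longleftrightarrow> u \<in> \<Gamma> - {0} \<and> v \<in> \<Gamma>' - {0} \<and>
     ((\<lambda>(x, y). vec_cos x y) has_derivative (\<lambda>_. 0)) (at (u, v) within \<Gamma> \<times> \<Gamma>')"

definition stationary_angles :: "'a::euclidean_space set \<Rightarrow> 'a set \<Rightarrow> real set" where
  "stationary_angles \<Gamma> \<Gamma>' = {line_angle u v | u v. stationary_lines \<Gamma> \<Gamma>' u v}"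

text \<open>
  For planes, the two stationary values (possibly coinciding) make up the set
  \<open>stationary_angles \<Gamma> \<Gamma>'\<close>; both being equal to \<open>\<phi>\<close> says that this set is \<open>{\<phi>}\<close>.
  The lemma \<open>isoclinic_iff_matrix\<close> below gives the equivalent matrix form.
\<close>

definition isoclinic :: "real \<Rightarrow> 'a::euclidean_space set \<Rightarrow> 'a set \<Rightarrow> bool" where
  "isoclinic \<phi> \<Gamma> \<Gamma>' \<longleftrightarrow> stationary_angles \<Gamma> \<Gamma>' = {\<phi>}"

definition equi_isoclinic :: "real \<Rightarrow> nat \<Rightarrow> (nat \<Rightarrow> 'a::euclidean_space set) \<Rightarrow> bool" where
  "equi_isoclinic l n \<Gamma> \<longleftrightarrow> (\<forall>i<n. plane (\<Gamma> i)) \<and>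
     (\<exists>\<phi>\<in>{0<..pi/2}. l = (cos \<phi>)\<^sup>2 \<and>
        (\<forall>i<n. \<forall>j<n. i \<noteq> j \<longrightarrow> isoclinic \<phi> (\<Gamma> i) (\<Gamma> j)))"

text \<open>
  The maximum number of equi-isoclinic planes with parameter \<open>l\<close> in the Euclidean space \<open>'a\<close>.
  The supremum is taken in \<open>enat\<close>, so a finite non-zero value is attained, i.e. is a maximum.
\<close>

definition max_equi_isoclinic :: "real \<Rightarrow> 'a::euclidean_space itself \<Rightarrow> enat" where
  "max_equi_isoclinic l _ = (SUP n\<in>{n. \<exists>\<Gamma> :: nat \<Rightarrow> 'a set. equi_isoclinic l n \<Gamma>}. enat n)"


subsection \<open>The matrix form of isoclinicity\<close>

lemma stationary_lines_iff:
  fixes u v :: "'a::euclidean_space"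
  assumes S: "subspace \<Gamma>" "subspace \<Gamma>'" and u: "u \<in> \<Gamma>" "u \<noteq> 0" and v: "v \<in> \<Gamma>'" "v \<noteq> 0"
  shows "stationary_lines \<Gamma> \<Gamma>' u v \<longleftrightarrow>
    (\<forall>x\<in>\<Gamma>. x \<bullet> v = (u \<bullet> v) / (u \<bullet> u) * (x \<bullet> u)) \<and>
    (\<forall>y\<in>\<Gamma>'. u \<bullet> y = (u \<bullet> v) / (v \<bullet> v) * (v \<bullet> y))"
proof -
  define f where "f = (\<lambda>p::'a \<times> 'a. vec_cos (fst p) (snd p))"
  define N where "N = norm u * norm v"
  define D where "D = (\<lambda>p. ((fst p \<bullet> v + u \<bullet> snd p)
      - (u \<bullet> v) * ((u \<bullet> fst p) / (u \<bullet> u) + (v \<bullet> snd p) / (v \<bullet> v))) / N)"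
  have N: "N > 0" using u v by (simp add: N_def)
  have uu: "u \<bullet> u = norm u * norm u" and vv: "v \<bullet> v = norm v * norm v"
    by (simp_all add: dot_square_norm power2_eq_square)
  have nu: "norm u \<noteq> 0" "norm v \<noteq> 0" using u v by auto
  have D: "(f has_derivative D) (at (u, v))"
  proof -
    have 1: "((\<lambda>p. norm (fst p)) has_derivative (\<lambda>p. fst p \<bullet> sgn u)) (at (u, v))"
      by (rule has_derivative_compose[OF has_derivative_fst[OF has_derivative_ident]])
         (simp add: u has_derivative_norm)
    have 2: "((\<lambda>p. norm (snd p)) has_derivative (\<lambda>p. snd p \<bullet> sgn v)) (at (u, v))"
      by (rule has_derivative_compose[OF has_derivative_snd[OF has_derivative_ident]])
         (simp add: v has_derivative_norm)
    show ?thesis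
      unfolding f_def vec_cos_def
      apply (rule has_derivative_eq_rhs)
       apply (rule has_derivative_divide' has_derivative_inner has_derivative_mult 1 2
          has_derivative_fst has_derivative_snd has_derivative_ident)+
      using nu
       apply simp
      using nu
      apply (simp add: fun_eq_iff D_def N_def uu vv sgn_div_norm inner_commute divide_simps)
      apply (simp add: algebra_simps)
      done
  qed
  have lin: "linear D"
    using D has_derivative_linear by blast
  have *: "stationary_lines \<Gamma> \<Gamma>' u v \<longleftrightarrow> (\<forall>x\<in>\<Gamma>. \<forall>y\<in>\<Gamma>'. D (x, y) = 0)"
  proof
    assume "stationary_lines \<Gamma> \<Gamma>' u v"
    then have Z: "(f has_derivative (\<lambda>_. 0)) (at (u, v) within \<Gamma> \<times> \<Gamma>')"
      by (simp add: stationary_lines_def f_def case_prod_beta')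
    show "\<forall>x\<in>\<Gamma>. \<forall>y\<in>\<Gamma>'. D (x, y) = 0"
    proof (intro ballI)
      fix x y assume xy: "x \<in> \<Gamma>" "y \<in> \<Gamma>'"
      define g where "g = (\<lambda>t::real. (u, v) + t *\<^sub>R (x, y))"
      have g: "(g has_derivative (\<lambda>t. t *\<^sub>R (x, y))) (at 0)"
        unfolding g_def by (auto intro!: derivative_eq_intros)
      have im: "range g \<subseteq> \<Gamma> \<times> \<Gamma>'"
        using xy u v S by (auto simp: g_def subspace_add subspace_scale)
      have g0: "g 0 = (u, v)" by (simp add: g_def)
      have 1: "((\<lambda>t. f (g t)) has_derivative (\<lambda>t. 0)) (at 0)"
        using has_derivative_in_compose[OF g, of f "\<lambda>_. 0"]
          has_derivative_subset[OF Z im] g0 by simp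
      have 2: "((\<lambda>t. f (g t)) has_derivative (\<lambda>t. D (t *\<^sub>R (x, y)))) (at 0)"
        using has_derivative_compose[OF g, of f D] D g0 by simp
      have "(\<lambda>t::real. D (t *\<^sub>R (x, y))) = (\<lambda>t. 0)"
        using has_derivative_unique[OF 2 1] .
      from fun_cong[OF this, of 1] show "D (x, y) = 0" by simp
    qed
  next
    assume Z: "\<forall>x\<in>\<Gamma>. \<forall>y\<in>\<Gamma>'. D (x, y) = 0"
    have "(f has_derivative D) (at (u, v) within \<Gamma> \<times> \<Gamma>')"
      using D has_derivative_at_withinI by blast
    moreover have "\<forall>\<^sub>F p in at (u, v) within \<Gamma> \<times> \<Gamma>'.
        (1 / norm (p - (u, v))) *\<^sub>R (f p - (f (u, v) + D (p - (u, v)))) =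
        (1 / norm (p - (u, v))) *\<^sub>R (f p - (f (u, v) + 0))"
    proof -
      have "D (p - (u, v)) = 0" if "p \<in> \<Gamma> \<times> \<Gamma>'" for p
        using that Z S u v by (cases p) (auto simp: subspace_diff)
      then show ?thesis by (simp add: eventually_at_filter)
    qed
    ultimately have "(f has_derivative (\<lambda>_. 0)) (at (u, v) within \<Gamma> \<times> \<Gamma>')"
      unfolding has_derivative_within
      by (auto simp del: add_0_right elim: Lim_transform_eventually)
    then show "stationary_lines \<Gamma> \<Gamma>' u v"
      using u v by (simp add: stationary_lines_def f_def case_prod_beta')
  qed
  have D1: "D (x, 0) = 0 \<longleftrightarrow> x \<bullet> v = (u \<bullet> v) / (u \<bullet> u) * (x \<bullet> u)" for x
    using N by (simp add: D_def inner_commute)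
  have D2: "D (0, y) = 0 \<longleftrightarrow> u \<bullet> y = (u \<bullet> v) / (v \<bullet> v) * (v \<bullet> y)" for y
    using N by (simp add: D_def)
  have D3: "D (x, y) = D (x, 0) + D (0, y)" for x y
    using linear_add[OF lin, of "(x, 0)" "(0, y)"] by simp
  show ?thesis
    unfolding * using D1 D2 D3 S subspace_0 by (metis add_0)
qed

lemma isoclinic_iff_matrix:
  fixes a b :: "2 \<Rightarrow> 'a::euclidean_space"
  assumes a: "\<And>i j. a i \<bullet> a j = (if i = j then 1 else 0)" "span (range a) = \<Gamma>"
      and b: "\<And>i j. b i \<bullet> b j = (if i = j then 1 else 0)" "span (range b) = \<Gamma>'"
      and \<phi>: "0 \<le> \<phi>" "\<phi> \<le> pi / 2"
  defines "A \<equiv> (\<chi> i j. a i \<bullet> b j) :: real ^ 2 ^ 2"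
  shows "isoclinic \<phi> \<Gamma> \<Gamma>' \<longleftrightarrow> A ** transpose A = (cos \<phi>)\<^sup>2 *\<^sub>R mat 1"
proof -
  define c where "c = cos \<phi>"
  have c: "0 \<le> c" "c \<le> 1" "arccos c = \<phi>"
    using \<phi> by (auto simp: c_def cos_ge_zero arccos_cos)
  have S: "subspace \<Gamma>" "subspace \<Gamma>'" using a b by auto
  have am: "a i \<in> \<Gamma>" and bm: "b i \<in> \<Gamma>'" for i
    using a b by (auto intro: span_base)
  have exa: "x = (x \<bullet> a 1) *\<^sub>R a 1 + (x \<bullet> a 2) *\<^sub>R a 2" if "x \<in> \<Gamma>" for x
  proof -
    have "x \<in> span {a 1, a 2}" using that a(2) by (simp add: UNIV_2)
    then obtain s t where "x - s *\<^sub>R a 1 = t *\<^sub>R a 2"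
      by (auto simp: span_insert span_singleton)
    then have "x = s *\<^sub>R a 1 + t *\<^sub>R a 2" by (simp add: algebra_simps)
    then show ?thesis by (simp add: inner_add_left a)
  qed
  have exb: "x = (x \<bullet> b 1) *\<^sub>R b 1 + (x \<bullet> b 2) *\<^sub>R b 2" if "x \<in> \<Gamma>'" for x
  proof -
    have "x \<in> span {b 1, b 2}" using that b(2) by (simp add: UNIV_2)
    then obtain s t where "x - s *\<^sub>R b 1 = t *\<^sub>R b 2"
      by (auto simp: span_insert span_singleton)
    then have "x = s *\<^sub>R b 1 + t *\<^sub>R b 2" by (simp add: algebra_simps)
    then show ?thesis by (simp add: inner_add_left b)
  qed
  have ia: "x \<bullet> y = (x \<bullet> a 1) * (y \<bullet> a 1) + (x \<bullet> a 2) * (y \<bullet> a 2)" if "x \<in> \<Gamma>" for x y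
    using arg_cong[OF exa[OF that], of "\<lambda>z. z \<bullet> y"]
    by (simp add: inner_add_left inner_commute[of y])
  have ib: "x \<bullet> y = (x \<bullet> b 1) * (y \<bullet> b 1) + (x \<bullet> b 2) * (y \<bullet> b 2)" if "x \<in> \<Gamma>'" for x y
    using arg_cong[OF exb[OF that], of "\<lambda>z. z \<bullet> y"]
    by (simp add: inner_add_left inner_commute[of y])
  define Q where "Q = (\<lambda>x y. (x \<bullet> b 1) * (y \<bullet> b 1) + (x \<bullet> b 2) * (y \<bullet> b 2))"
  have Qlin: "Q (s *\<^sub>R x + t *\<^sub>R x') (s' *\<^sub>R y + t' *\<^sub>R y') =
      s * s' * Q x y + s * t' * Q x y' + t * s' * Q x' y + t * t' * Q x' y'" for s t s' t' x x' y y'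
    by (simp add: Q_def inner_add_left algebra_simps)
  have mat: "A ** transpose A = c\<^sup>2 *\<^sub>R mat 1 \<longleftrightarrow> (\<forall>i k. Q (a i) (a k) = c\<^sup>2 * (a i \<bullet> a k))"
    by (simp add: vec_eq_iff matrix_matrix_mult_def transpose_def mat_def A_def Q_def sum_2 a)
  obtain u1 v1 where uv1: "u1 \<in> \<Gamma>" "v1 \<in> \<Gamma>'" "norm u1 = 1" "norm v1 = 1"
    and mx: "\<And>x y. x \<in> \<Gamma> \<Longrightarrow> y \<in> \<Gamma>' \<Longrightarrow> norm x = 1 \<Longrightarrow> norm y = 1 \<Longrightarrow> x \<bullet> y \<le> u1 \<bullet> v1"
  proof -
    let ?K = "(\<Gamma> \<inter> sphere 0 1) \<times> (\<Gamma>' \<inter> sphere 0 1)"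
    have "compact ?K"
      using S by (intro compact_Times closed_Int_compact closed_subspace) auto
    moreover have "(a 1, b 1) \<in> ?K" using am bm a b by (auto simp: norm_eq_1)
    ultimately have "\<exists>p\<in>?K. \<forall>q\<in>?K. fst q \<bullet> snd q \<le> fst p \<bullet> snd p"
      by (intro continuous_attains_sup continuous_intros) auto
    then show ?thesis using that by fastforce
  qed
  define M where "M = u1 \<bullet> v1"
  have M: "x \<bullet> y \<le> M * norm x * norm y" if "x \<in> \<Gamma>" "y \<in> \<Gamma>'" for x y
  proof (cases "x = 0 \<or> y = 0")
    case False
    have "(x /\<^sub>R norm x) \<bullet> (y /\<^sub>R norm y) \<le> M"
      unfolding M_def using that False S by (intro mx) (auto simp: subspace_scale)
    then show ?thesis using False by (simp add: field_simps)
  qed auto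
  have n1: "u1 \<bullet> u1 = 1" "v1 \<bullet> v1 = 1" using uv1 by (auto simp: norm_eq_1)
  have M0: "M \<ge> 0"
    using mx[of "- u1" v1] uv1 S by (auto simp: M_def subspace_neg)
  have close: "w = M *\<^sub>R z" if "w \<bullet> w \<le> M * norm w" "z \<bullet> z = 1" "z \<bullet> w = M" for w z :: 'a
  proof -
    have "norm w * norm w \<le> M * norm w" using that(1) by (simp add: dot_square_norm power2_eq_square)
    then have "norm w \<le> M" using M0 by (cases "norm w = 0") (auto simp: mult_le_cancel_right)
    then have "w \<bullet> w \<le> M * M"
      by (simp add: dot_square_norm power2_eq_square mult_mono M0)
    moreover have "(w - M *\<^sub>R z) \<bullet> (w - M *\<^sub>R z) = w \<bullet> w - 2 * M * (z \<bullet> w) + M * M * (z \<bullet> z)"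
      by (simp add: inner_diff_left inner_diff_right inner_commute algebra_simps)
    ultimately have "(w - M *\<^sub>R z) \<bullet> (w - M *\<^sub>R z) \<le> 0" using that by simp
    then have "w - M *\<^sub>R z = 0" by (metis inner_eq_zero_iff inner_ge_zero order_antisym)
    then show ?thesis by simp
  qed
  have x1: "x \<bullet> v1 = M * (x \<bullet> u1)" if "x \<in> \<Gamma>" for x
  proof -
    define w where "w = (v1 \<bullet> a 1) *\<^sub>R a 1 + (v1 \<bullet> a 2) *\<^sub>R a 2"
    have wm: "w \<in> \<Gamma>" using S am by (simp add: w_def subspace_add subspace_scale)
    have xw: "x \<bullet> v1 = x \<bullet> w" if "x \<in> \<Gamma>" for x
      using ia[OF that] by (simp add: w_def inner_add_right inner_commute algebra_simps)
    have "w = M *\<^sub>R u1"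
      using xw[OF wm] M[OF wm uv1(2)] uv1 n1 xw[OF uv1(1)] by (intro close) (auto simp: M_def)
    then show ?thesis using xw[OF that] by simp
  qed
  have y1: "u1 \<bullet> y = M * (v1 \<bullet> y)" if "y \<in> \<Gamma>'" for y
  proof -
    define w where "w = (u1 \<bullet> b 1) *\<^sub>R b 1 + (u1 \<bullet> b 2) *\<^sub>R b 2"
    have wm: "w \<in> \<Gamma>'" using S bm by (simp add: w_def subspace_add subspace_scale)
    have xw: "u1 \<bullet> x = w \<bullet> x" if "x \<in> \<Gamma>'" for x
      using ib[OF that, of u1] by (simp add: w_def inner_add_left inner_commute algebra_simps)
    have "w = M *\<^sub>R v1"
      using xw[OF wm] M[OF uv1(1) wm] uv1 n1 xw[OF uv1(2)]
      by (intro close) (auto simp: M_def inner_commute)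
    then show ?thesis using xw[OF that] by simp
  qed
  have nz1: "u1 \<noteq> 0" "v1 \<noteq> 0" using n1 by auto
  have st1: "stationary_lines \<Gamma> \<Gamma>' u1 v1"
    using stationary_lines_iff[OF S uv1(1) nz1(1) uv1(2) nz1(2)] x1 y1 n1 by (auto simp: M_def)
  have backward: "isoclinic \<phi> \<Gamma> \<Gamma>'" if "\<forall>i k. Q (a i) (a k) = c\<^sup>2 * (a i \<bullet> a k)"
  proof -
    have QQ: "Q x x = c\<^sup>2 * (x \<bullet> x)" if "x \<in> \<Gamma>" for x
    proof -
      have "Q x x = c\<^sup>2 * ((x \<bullet> a 1) * (x \<bullet> a 1) + (x \<bullet> a 2) * (x \<bullet> a 2))"
        using \<open>\<forall>i k. _\<close> a(1)
        by (subst (1 2) exa[OF that]) (simp only: Qlin, simp add: algebra_simps)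
      then show ?thesis using ia[OF that, of x] by simp
    qed
    have "line_angle u v = \<phi>" if st: "stationary_lines \<Gamma> \<Gamma>' u v" for u v
    proof -
      have uv: "u \<in> \<Gamma>" "u \<noteq> 0" "v \<in> \<Gamma>'" "v \<noteq> 0"
        using st by (auto simp: stationary_lines_def)
      have e: "u \<bullet> b i = (u \<bullet> v) / (v \<bullet> v) * (v \<bullet> b i)" for i
        using st stationary_lines_iff[OF S uv] bm by blast
      define r where "r = (u \<bullet> v) / (v \<bullet> v)"
      have "Q u u = r\<^sup>2 * (v \<bullet> v)"
        unfolding Q_def e r_def[symmetric] using ib[OF uv(3), of v]
        by (simp add: power2_eq_square algebra_simps)
      with QQ[OF uv(1)] have "c\<^sup>2 * (norm u)\<^sup>2 = r\<^sup>2 * (norm v)\<^sup>2"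
        by (simp add: dot_square_norm)
      then have "(c * norm u)\<^sup>2 = (\<bar>r\<bar> * norm v)\<^sup>2" by (simp add: power_mult_distrib)
      then have cr: "c * norm u = \<bar>r\<bar> * norm v"
        using c by (simp add: power2_eq_iff_nonneg)
      have "\<bar>vec_cos u v\<bar> = \<bar>r\<bar> * norm v / norm u"
        using uv by (simp add: vec_cos_def r_def abs_mult dot_square_norm power2_eq_square)
      also have "\<dots> = c" unfolding cr[symmetric] using uv by simp
      finally show ?thesis using c by (simp add: line_angle_def)
    qed
    then show ?thesis using st1 by (auto simp: isoclinic_def stationary_angles_def)
  qed
  have forward: "\<forall>i k. Q (a i) (a k) = c\<^sup>2 * (a i \<bullet> a k)" if iso: "isoclinic \<phi> \<Gamma> \<Gamma>'"
  proof -
    define u2 where "u2 = (- (u1 \<bullet> a 2)) *\<^sub>R a 1 + (u1 \<bullet> a 1) *\<^sub>R a 2"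
    define v2 where "v2 = (- (v1 \<bullet> b 2)) *\<^sub>R b 1 + (v1 \<bullet> b 1) *\<^sub>R b 2"
    have uv2: "u2 \<in> \<Gamma>" "v2 \<in> \<Gamma>'"
      using S am bm by (auto simp only: u2_def v2_def intro!: subspace_add subspace_scale)
    have n2: "u2 \<bullet> u2 = 1" "v2 \<bullet> v2 = 1" "u1 \<bullet> u2 = 0" "v1 \<bullet> v2 = 0"
      using ia[OF uv1(1), of u1] ib[OF uv1(2), of v1] n1
      by (simp_all add: u2_def v2_def inner_add_left inner_add_right inner_diff_left inner_diff_right
          a b inner_commute algebra_simps)
    have rot: "x = (x \<bullet> p) *\<^sub>R p + (x \<bullet> q) *\<^sub>R q"
      if x: "x = (x \<bullet> e) *\<^sub>R e + (x \<bullet> f) *\<^sub>R f" and st: "s * s + t * t = 1"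
        and pq: "p = s *\<^sub>R e + t *\<^sub>R f" "q = (- t) *\<^sub>R e + s *\<^sub>R f"
      for x p q e f :: 'a and s t :: real
    proof -
      define \<alpha> \<beta> where "\<alpha> = x \<bullet> e" and "\<beta> = x \<bullet> f"
      have "(x \<bullet> p) *\<^sub>R p + (x \<bullet> q) *\<^sub>R q =
          ((s * s + t * t) * \<alpha>) *\<^sub>R e + ((s * s + t * t) * \<beta>) *\<^sub>R f"
        by (simp add: pq inner_add_right inner_diff_right \<alpha>_def[symmetric] \<beta>_def[symmetric]
            algebra_simps)
      then show ?thesis using x st by (simp add: \<alpha>_def \<beta>_def)
    qed
    have exu: "x = (x \<bullet> u1) *\<^sub>R u1 + (x \<bullet> u2) *\<^sub>R u2" if "x \<in> \<Gamma>" for x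
      using rot[OF exa[OF that] _ exa[OF uv1(1)] u2_def] ia[OF uv1(1), of u1] n1 by simp
    have exv: "x = (x \<bullet> v1) *\<^sub>R v1 + (x \<bullet> v2) *\<^sub>R v2" if "x \<in> \<Gamma>'" for x
      using rot[OF exb[OF that] _ exb[OF uv1(2)] v2_def] ib[OF uv1(2), of v1] n1 by simp
    define N where "N = u2 \<bullet> v2"
    have x2: "x \<bullet> v2 = N * (x \<bullet> u2)" if "x \<in> \<Gamma>" for x
      using y1[OF uv2(2)] n2
      by (subst exu[OF that]) (simp add: inner_add_left N_def)
    have y2: "u2 \<bullet> y = N * (v2 \<bullet> y)" if "y \<in> \<Gamma>'" for y
      using x1[OF uv2(1)] n2
      by (subst exv[OF that]) (simp add: inner_add_right N_def inner_commute)
    have nz2: "u2 \<noteq> 0" "v2 \<noteq> 0" using n2 by auto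
    have st2: "stationary_lines \<Gamma> \<Gamma>' u2 v2"
      using stationary_lines_iff[OF S uv2(1) nz2(1) uv2(2) nz2(2)] x2 y2 n2 by (auto simp: N_def)
    have key: "(u \<bullet> v)\<^sup>2 = c\<^sup>2" if "stationary_lines \<Gamma> \<Gamma>' u v" "u \<bullet> u = 1" "v \<bullet> v = 1" for u v
    proof -
      have "line_angle u v = \<phi>"
        using iso that by (auto simp: isoclinic_def stationary_angles_def)
      moreover have "vec_cos u v = u \<bullet> v" "\<bar>u \<bullet> v\<bar> \<le> 1"
        using that Cauchy_Schwarz_ineq2[of u v] by (auto simp: vec_cos_def norm_eq_sqrt_inner)
      ultimately have "arccos \<bar>u \<bullet> v\<bar> = \<phi>" "\<bar>u \<bullet> v\<bar> \<le> 1" by (auto simp: line_angle_def)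
      then have "\<bar>u \<bullet> v\<bar> = c" unfolding c_def by (metis cos_arccos_abs abs_abs)
      then show ?thesis by (metis power2_abs)
    qed
    have MN: "M * M = c\<^sup>2" "N * N = c\<^sup>2"
      using key[OF st1] key[OF st2] n1 n2 by (auto simp: M_def N_def power2_eq_square)
    have q: "Q u1 u1 = M * M * (v1 \<bullet> v1)" "Q u2 u2 = N * N * (v2 \<bullet> v2)"
        "Q u1 u2 = M * N * (v1 \<bullet> v2)" "Q u2 u1 = M * N * (v1 \<bullet> v2)"
      using ib[OF uv1(2), of v1] ib[OF uv1(2), of v2] ib[OF uv2(2), of v2]
      by (simp_all only: Q_def y1[OF bm] y2[OF bm]) (simp_all add: algebra_simps)
    have "Q x y = c\<^sup>2 * (x \<bullet> y)" if "x \<in> \<Gamma>" "y \<in> \<Gamma>" for x y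
    proof -
      have "Q x y = c\<^sup>2 * ((x \<bullet> u1) * (y \<bullet> u1) + (x \<bullet> u2) * (y \<bullet> u2))"
        by (subst exu[OF that(1)], subst exu[OF that(2)], subst Qlin)
           (simp add: q n1 n2 MN algebra_simps)
      also have "(x \<bullet> u1) * (y \<bullet> u1) + (x \<bullet> u2) * (y \<bullet> u2) = x \<bullet> y"
        using arg_cong[OF exu[OF that(1)], of "\<lambda>z. z \<bullet> y"]
        by (simp add: inner_add_left inner_commute[of y])
      finally show ?thesis .
    qed
    then show ?thesis using am by blast
  qed
  show ?thesis using mat forward backward unfolding c_def by blast
qed

end

(*
  Upper bound: the orthonormal frames of n equi-isoclinic planes are 2n vectors whose squared
  inner products sum to 2n (1 + (n - 1) l); the Welch bound gives 2n <= r (1 + (n - 1) l), which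
  for l = 1 / (r - 1) means n <= r.

  Lower bound: let q = 2k - 1 be the order of the finite field and Q its Paley matrix, which is
  symmetric because q = 1 mod 4. Choosing a^2 = 1 / (q - 1) and b^2 = (q - 2) / (q - 1), the
  matrix D = a (E - I) + i b Q, with E the all-ones matrix, is complex symmetric with zero diagonal, unimodular entries off the
  diagonal and D D* = (q - 1) I. Hence z |-> D (cnj z) / sqrt (q - 1) is an antilinear isometric
  involution of C^q. Its fixed space is a real form, so it has real dimension q, and the orthogonal
  projections of the q complex coordinate lines to it are the required planes.

  The field is cut out of the algebraic closure of Z/p as the set of the roots of x^q = x.
*)

theory Submission
  imports
    Defs
    "Berlekamp_Zassenhaus.Finite_Field"
    "HOL-Algebra.Algebraic_Closure_Type"
begin

hide_const (open) Divisibility.prime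
unbundle no Formal_Power_Series.fps_syntax

section \<open>The prime field and the q roots of x^q = x\<close>

text \<open>The alternative \<open>n = 1\<close> guarantees a witness for every \<open>n\<close>, so
  the chosen number is prime even for a one-element index type and the \<open>prime_card\<close>
  instance holds for all finite types.\<close>

definition some_prime_factor :: "nat \<Rightarrow> nat" where
  "some_prime_factor n = (SOME p. prime p \<and> (n = 1 \<or> p dvd n))"

lemma some_prime_factor:
  "prime (some_prime_factor n)" "n \<noteq> 1 \<Longrightarrow> some_prime_factor n dvd n"
proof -
  have "\<exists>p::nat. prime p \<and> (n = 1 \<or> p dvd n)"
    using prime_factor_nat[of n] two_is_prime_nat by blast
  from someI_ex[OF this]
  show "prime (some_prime_factor n)" "n \<noteq> 1 \<Longrightarrow> some_prime_factor n dvd n"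
    by (auto simp: some_prime_factor_def)
qed

text \<open>
  Types cannot depend on the number \<open>p\<close>. When \<open>CARD('n)\<close> is a power of \<open>p\<close>, the following type
  recovers \<open>p\<close> from \<open>'n\<close>, so that the prime field is available as a type of class \<open>field\<close>.
\<close>

typedef (overloaded) 'n prime_index = "{..<some_prime_factor CARD('n::finite)}"
  using some_prime_factor(1) prime_gt_0_nat by blast

lemma CARD_prime_index: "CARD('n prime_index) = some_prime_factor CARD('n::finite)"
  by (simp add: type_definition.card[OF type_definition_prime_index])

instance prime_index :: (finite) prime_card
  by standard (simp add: CARD_prime_index some_prime_factor)

text \<open>Since q vanishes in the field, x^q - x has derivative -1. A repeated root would be a
  root of the derivative, so the q linear factors are distinct.\<close>

lemma card_power_eq_self:
  fixes q :: nat
  assumes "of_nat q = (0::'a::alg_closed_field)" "q > 1"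
  shows "card {x::'a. x ^ q = x} = q"
proof -
  define f where "f = Polynomial.monom (1::'a) q - Polynomial.monom 1 1"
  have dg: "Polynomial.degree f = q"
    unfolding f_def diff_conv_add_uminus using assms
    by (subst degree_add_eq_left) (auto simp: Polynomial.degree_monom_eq)
  then have "f \<noteq> 0" using assms by auto
  then obtain A where A: "size A = q"
      "f = Polynomial.smult (Polynomial.lead_coeff f) (\<Prod>x\<in>#A. [:-x, 1:])"
    using alg_closed_imp_factorization dg by metis
  have lc: "Polynomial.lead_coeff f = 1"
    unfolding dg unfolding f_def using assms by simp
  have f: "f = (\<Prod>x\<in>#A. [:-x, 1:])"
    using A(2) lc by simp
  have roots: "{x. x ^ q = x} = set_mset A"
  proof -
    have "x ^ q = x \<longleftrightarrow> poly f x = 0" for x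
      by (simp add: f_def poly_monom)
    moreover have "poly f x = 0 \<longleftrightarrow> x \<in># A" for x
      by (auto simp: f poly_prod_mset prod_mset_zero_iff)
    ultimately show ?thesis by auto
  qed
  have pd: "pderiv f = - 1"
    using assms by (simp add: f_def pderiv_diff pderiv_monom monom_eq_1)
  have "count A x = 1" if "x \<in># A" for x
  proof (rule ccontr)
    from multi_member_split[OF that] obtain B where B: "A = add_mset x B" by blast
    assume "count A x \<noteq> 1"
    with B obtain C where "A = add_mset x (add_mset x C)"
      using multi_member_split[of x B] by (auto simp: not_in_iff)
    then have "f = [:-x, 1:] * ([:-x, 1:] * (\<Prod>x\<in>#C. [:-x, 1:]))"
      by (simp add: f)
    then have "poly (pderiv f) x = 0"
      by (simp only: pderiv_mult poly_add poly_mult) simp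
    then show False using pd by simp
  qed
  then have "size A = card (set_mset A)"
    by (simp add: size_multiset_overloaded_eq)
  then show ?thesis using roots A by simp
qed

section \<open>Quadratic character and Paley matrix\<close>

text \<open>Euler's criterion: x^h squares to 1 on non-zero elements, so its sign gives the
  character. Even \<open>h\<close> makes the character even. The shifted correlation -1 becomes the
  inner product of two rows of the Paley matrix.\<close>

lemma quadratic_character:
  fixes K :: "'a::field set" and h :: nat
  assumes K: "K = {x. x ^ (2 * h + 1) = x}" and card: "card K = 2 * h + 1"
    and h: "h > 0" "even h" and two: "(1::'a) \<noteq> - 1"
    and add: "\<And>x y. x \<in> K \<Longrightarrow> y \<in> K \<Longrightarrow> x + y \<in> K"
  obtains \<eta> :: "'a \<Rightarrow> real" where "\<eta> 0 = 0" "\<And>x. x \<in> K \<Longrightarrow> x \<noteq> 0 \<Longrightarrow> (\<eta> x)\<^sup>2 = 1"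
    "\<And>x. \<eta> (- x) = \<eta> x" "sum \<eta> K = 0"
    "\<And>c. c \<in> K \<Longrightarrow> c \<noteq> 0 \<Longrightarrow> (\<Sum>y\<in>K. \<eta> y * \<eta> (y + c)) = - 1"
proof -
  define \<eta> :: "'a \<Rightarrow> real" where "\<eta> x = (if x = 0 then 0 else if x ^ h = 1 then 1 else - 1)" for x
  have fin: "finite K" using card card_ge_0_finite[of K] by simp
  have K0: "0 \<in> K" and K1: "1 \<in> K" by (auto simp: K)
  have mult: "x * y \<in> K" if "x \<in> K" "y \<in> K" for x y
    using that by (simp only: K mem_Collect_eq power_mult_distrib)
  have inv: "inverse x \<in> K" if "x \<in> K" for x
    using that by (simp only: K mem_Collect_eq power_inverse)
  have neg: "- x \<in> K" if "x \<in> K" for x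
    using that by (simp add: K)
  have pm: "x ^ h = 1 \<or> x ^ h = - 1" if "x \<in> K" "x \<noteq> 0" for x
  proof -
    have "x * (x ^ h)\<^sup>2 = x * 1"
      using that by (simp add: K power_even_eq)
    then show ?thesis
      using that by (simp add: power2_eq_1_iff)
  qed
  have \<eta>_mult: "\<eta> (x * y) = \<eta> x * \<eta> y" if "x \<in> K" "y \<in> K" for x y
    using pm[OF that(1)] pm[OF that(2)] two
    by (cases "x = 0"; cases "y = 0") (auto simp: \<eta>_def power_mult_distrib)
  have sq: "(\<eta> x)\<^sup>2 = 1" if "x \<noteq> 0" for x
    by (simp add: \<eta>_def that)
  \<comment> \<open>A non-residue exists because x^h - 1 has at most h roots, while \<open>K\<close>
    has 2h non-zero elements.\<close>
  obtain g where g: "g \<in> K" "g \<noteq> 0" "\<eta> g = - 1"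
  proof -
    define f where "f = Polynomial.monom (1::'a) h - 1"
    have "Polynomial.coeff f h = 1" using h by (simp add: f_def)
    then have "f \<noteq> 0" by auto
    have "Polynomial.degree f \<le> h"
      unfolding f_def by (intro degree_diff_le) (auto simp: Polynomial.degree_monom_eq)
    have eq: "{x. poly f x = 0} = {x. x ^ h = 1}" by (simp add: f_def poly_monom)
    have "card {x::'a. x ^ h = 1} \<le> h" "finite {x::'a. x ^ h = 1}"
      using card_poly_roots_bound[OF \<open>f \<noteq> 0\<close>] poly_roots_finite[OF \<open>f \<noteq> 0\<close>] \<open>_ \<le> h\<close>
      unfolding eq by auto
    then have "card (insert 0 {x::'a. x ^ h = 1}) \<le> h + 1"
      by (simp add: card_insert_if)
    then have "\<not> K \<subseteq> insert 0 {x::'a. x ^ h = 1}"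
      using card h card_mono[of "insert 0 {x::'a. x ^ h = 1}" K] \<open>finite {x::'a. x ^ h = 1}\<close> by auto
    then obtain g where "g \<in> K" "g \<noteq> 0" "g ^ h \<noteq> 1" by auto
    then show ?thesis by (intro that[of g]) (auto simp: \<eta>_def)
  qed
  have s0: "sum \<eta> K = 0"
  proof -
    \<comment> \<open>Multiplication by the non-residue permutes \<open>K\<close> and flips the sign
      of the character, so the sum equals its own negative.\<close>
    have "sum \<eta> K = (\<Sum>x\<in>K. \<eta> (g * x))"
      by (rule sum.reindex_bij_witness[of _ "\<lambda>x. g * x" "\<lambda>x. inverse g * x"])
         (use g mult inv in \<open>auto simp flip: mult.assoc\<close>)
    also have "\<dots> = - sum \<eta> K"
      using g by (simp add: \<eta>_mult flip: sum_negf)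
    finally show ?thesis by simp
  qed
  have jac: "(\<Sum>y\<in>K. \<eta> y * \<eta> (y + c)) = - 1" if c: "c \<in> K" "c \<noteq> 0" for c
  proof -
    have "(\<Sum>y\<in>K. \<eta> y * \<eta> (y + c)) = (\<Sum>y\<in>K - {0}. \<eta> y * \<eta> (y + c))"
      using fin by (intro sum.mono_neutral_right) (auto simp: \<eta>_def)
    \<comment> \<open>Factor y out of y + c; the two factors \<open>\<eta> y\<close> cancel. The map
      y -> 1 + c/y then carries the non-zero elements onto \<open>K - {1}\<close>, so only the term
      \<open>\<eta> 1 = 1\<close> is missing from the vanishing full sum.\<close>
    also have "\<dots> = (\<Sum>y\<in>K - {0}. \<eta> (1 + c * inverse y))"
    proof (intro sum.cong refl)
      fix y assume y: "y \<in> K - {0}"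
      have "y + c = y * (1 + c * inverse y)" using y by (simp add: field_simps)
      then have "\<eta> (y + c) = \<eta> y * \<eta> (1 + c * inverse y)"
        using \<eta>_mult y add mult inv c K1 by (metis DiffD1)
      then show "\<eta> y * \<eta> (y + c) = \<eta> (1 + c * inverse y)"
        using sq[of y] y by (simp add: power2_eq_square)
    qed
    also have "\<dots> = (\<Sum>z\<in>K - {1}. \<eta> z)"
    proof (rule sum.reindex_bij_witness[of _ "\<lambda>z. c * inverse (z - 1)" "\<lambda>y. 1 + c * inverse y"])
      fix z assume z: "z \<in> K - {1}"
      then have "z - 1 \<in> K" using add[of z "- 1"] neg[OF K1] by simp
      then show "c * inverse (z - 1) \<in> K - {0}" using z c mult inv by auto
      show "1 + c * inverse (c * inverse (z - 1)) = z"
        using c z by (simp add: field_simps)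
    qed (use c K1 add mult inv in auto)
    also have "\<dots> = sum \<eta> K - \<eta> 1"
      using fin K1 by (simp add: sum_diff1)
    finally show ?thesis using s0 by (simp add: \<eta>_def)
  qed
  show ?thesis
    by (rule that[of \<eta>]) (use sq s0 jac h in \<open>auto simp: \<eta>_def\<close>)
qed

text \<open>Indexing the field \<open>K\<close> of order \<open>CARD('n)\<close> by a bijection
  \<open>\<phi>\<close>, the matrix is \<open>\<eta> (\<phi> i - \<phi> j)\<close>. It is symmetric
  because the order is 1 mod 4, which makes \<open>\<eta>\<close> even.\<close>

lemma paley_core:
  fixes p \<alpha> :: nat
  assumes p: "prime p" and card: "CARD('n::finite) = p ^ \<alpha>"
    and mod4: "CARD('n::finite) mod 4 = 1" and gt1: "CARD('n::finite) > 1"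
  obtains Q :: "'n::finite \<Rightarrow> 'n \<Rightarrow> real" where "\<And>i. Q i i = 0" "\<And>i j. i \<noteq> j \<Longrightarrow> (Q i j)\<^sup>2 = 1"
    "\<And>i j. Q i j = Q j i" "\<And>i. (\<Sum>j\<in>UNIV. Q i j) = 0"
    "\<And>i j. i \<noteq> j \<Longrightarrow> (\<Sum>k\<in>UNIV. Q i k * Q j k) = - 1"
proof -
  have char: "CHAR('n prime_index mod_ring alg_closure) = p"
  proof -
    \<comment> \<open>The only prime factor of p^\<alpha> is p, so the characteristic recovered from
      the type is p.\<close>
    have "some_prime_factor CARD('n) dvd p"
      using prime_dvd_power some_prime_factor[of "CARD('n)"] gt1 by (metis card less_irrefl)
    then have "some_prime_factor CARD('n) = p"
      using some_prime_factor(1) p by (rule primes_dvd_imp_eq[rotated 2])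
    then show ?thesis
      by (simp add: CARD_prime_index)
  qed
  define K where "K = {x :: 'n prime_index mod_ring alg_closure. x ^ CARD('n) = x}"
  define h where "h = CARD('n) div 2"
  have q: "CARD('n) = 2 * h + 1" and h: "h > 0" "even h"
    using mod4 gt1 unfolding h_def by presburger+
  have "\<alpha> > 0" using card gt1 by (cases \<alpha>) auto
  have "of_nat CARD('n) = (0 :: 'n prime_index mod_ring alg_closure)"
    using char \<open>\<alpha> > 0\<close> unfolding card of_nat_eq_0_iff_char_dvd by simp
  then have cardK: "card K = CARD('n)"
    unfolding K_def by (rule card_power_eq_self) fact
  have Kh: "K = {x. x ^ (2 * h + 1) = x}"
    unfolding K_def q ..
  have two: "(1 :: 'n prime_index mod_ring alg_closure) \<noteq> - 1"
  proof
    assume "(1 :: 'n prime_index mod_ring alg_closure) = - 1"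
    then have "of_nat 2 = (0 :: 'n prime_index mod_ring alg_closure)"
      by (simp add: eq_neg_iff_add_eq_0)
    then have "p dvd 2" unfolding of_nat_eq_0_iff_char_dvd char .
    then have "p = 2" using p by (simp add: primes_dvd_imp_eq)
    then have "even CARD('n)" using card \<open>\<alpha> > 0\<close> by simp
    then show False using q by simp
  qed
  \<comment> \<open>The exponent is a power of the characteristic, so x -> x^q is an iterated
    Frobenius map and hence additive.\<close>
  have add: "x + y \<in> K" if "x \<in> K" "y \<in> K" for x y
    using that freshmans_dream'[of "CARD('n)" \<alpha> x y] p unfolding K_def char by (simp add: card)
  have neg: "- x \<in> K" if "x \<in> K" for x
    using that q by (simp add: K_def)
  have diff: "x - y \<in> K" if "x \<in> K" "y \<in> K" for x y
    using add[OF that(1) neg[OF that(2)]] by simp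
  obtain \<eta> :: "'n prime_index mod_ring alg_closure \<Rightarrow> real" where
    \<eta>: "\<eta> 0 = 0" "\<And>x. x \<in> K \<Longrightarrow> x \<noteq> 0 \<Longrightarrow> (\<eta> x)\<^sup>2 = 1"
    "\<And>x. \<eta> (- x) = \<eta> x" "sum \<eta> K = 0"
    "\<And>c. c \<in> K \<Longrightarrow> c \<noteq> 0 \<Longrightarrow> (\<Sum>y\<in>K. \<eta> y * \<eta> (y + c)) = - 1"
    using quadratic_character[OF Kh cardK[unfolded q] h two add] by blast
  have "finite K" using cardK card_ge_0_finite[of K] by simp
  then obtain \<phi> :: "'n \<Rightarrow> _" where \<phi>: "bij_betw \<phi> UNIV K"
    using finite_same_card_bij[of "UNIV :: 'n set" K] cardK by auto
  have \<phi>K: "\<phi> i \<in> K" for i using \<phi> by (auto simp: bij_betw_def)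
  have sum_eq: "(\<Sum>k\<in>UNIV. F (\<phi> i - \<phi> k)) = sum F K" for F :: "_ \<Rightarrow> real" and i
  proof -
    have "(\<Sum>k\<in>UNIV. F (\<phi> i - \<phi> k)) = (\<Sum>y\<in>K. F (\<phi> i - y))"
      by (rule sum.reindex_bij_betw[OF \<phi>])
    also have "\<dots> = sum F K"
      by (rule sum.reindex_bij_witness[of _ "\<lambda>x. \<phi> i - x" "\<lambda>x. \<phi> i - x"])
         (use diff \<phi>K in auto)
    finally show ?thesis .
  qed
  show ?thesis
  proof (rule that[of "\<lambda>i j. \<eta> (\<phi> i - \<phi> j)"])
    show "(\<eta> (\<phi> i - \<phi> j))\<^sup>2 = 1" if "i \<noteq> j" for i j
      using that \<phi> diff \<phi>K by (intro \<eta>) (auto simp: bij_betw_def inj_eq)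
    show "\<eta> (\<phi> i - \<phi> j) = \<eta> (\<phi> j - \<phi> i)" for i j
      using \<eta>(3)[of "\<phi> i - \<phi> j"] by simp
    show "(\<Sum>k\<in>UNIV. \<eta> (\<phi> i - \<phi> k) * \<eta> (\<phi> j - \<phi> k)) = - 1" if "i \<noteq> j" for i j
    proof -
      \<comment> \<open>Substituting y for \<open>\<phi> i - \<phi> k\<close> turns the product of
        two rows into a correlation with shift \<open>\<phi> j - \<phi> i\<close>.\<close>
      have "(\<Sum>k\<in>UNIV. \<eta> (\<phi> i - \<phi> k) * \<eta> (\<phi> j - \<phi> k)) =
          (\<Sum>y\<in>K. \<eta> y * \<eta> (y + (\<phi> j - \<phi> i)))"
        using sum_eq[of "\<lambda>y. \<eta> y * \<eta> (y + (\<phi> j - \<phi> i))" i] by simp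
      also have "\<dots> = - 1"
        using that \<phi> diff \<phi>K by (intro \<eta>) (auto simp: bij_betw_def inj_eq)
      finally show ?thesis .
    qed
  qed (simp_all add: \<eta> sum_eq)
qed

section \<open>Upper bound on the number of planes\<close>

text \<open>Let S be the sum of the rank-one matrices v_i v_i^T. Its trace is the left-hand sum,
  Cauchy-Schwarz bounds the squared trace by the dimension times the squared diagonal, and the
  squared Frobenius norm of S is the double sum of squared inner products.\<close>

lemma welch_bound:
  fixes v :: "'b \<Rightarrow> real ^ 'n"
  shows "(\<Sum>i\<in>I. v i \<bullet> v i)\<^sup>2 \<le> real CARD('n) * (\<Sum>i\<in>I. \<Sum>j\<in>I. (v i \<bullet> v j)\<^sup>2)"
proof -
  define S where "S a b = (\<Sum>i\<in>I. v i $ a * v i $ b)" for a b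
  have "(\<Sum>i\<in>I. v i \<bullet> v i) = (\<Sum>a\<in>UNIV. S a a)"
    unfolding S_def inner_vec_def by (subst sum.swap) simp
  then have "(\<Sum>i\<in>I. v i \<bullet> v i)\<^sup>2 \<le> real CARD('n) * (\<Sum>a\<in>UNIV. (S a a)\<^sup>2)"
    using sum_squared_le_sum_of_squares[of "\<lambda>a. S a a" UNIV] by (simp add: mult.commute)
  also have "(\<Sum>a\<in>UNIV. (S a a)\<^sup>2) \<le> (\<Sum>a\<in>UNIV. \<Sum>b\<in>UNIV. (S a b)\<^sup>2)"
    by (intro sum_mono member_le_sum) auto
  also have "\<dots> = (\<Sum>a\<in>UNIV. \<Sum>b\<in>UNIV. \<Sum>i\<in>I. \<Sum>j\<in>I. (v i $ a * v j $ a) * (v i $ b * v j $ b))"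
    unfolding S_def power2_eq_square sum_product by (intro sum.cong refl) (simp add: mult_ac)
  also have "\<dots> = (\<Sum>a\<in>UNIV. \<Sum>i\<in>I. \<Sum>b\<in>UNIV. \<Sum>j\<in>I. (v i $ a * v j $ a) * (v i $ b * v j $ b))"
    by (rule sum.cong[OF refl], rule sum.swap)
  also have "\<dots> = (\<Sum>i\<in>I. \<Sum>a\<in>UNIV. \<Sum>j\<in>I. \<Sum>b\<in>UNIV. (v i $ a * v j $ a) * (v i $ b * v j $ b))"
    by (subst sum.swap, rule sum.cong[OF refl], rule sum.cong[OF refl], rule sum.swap)
  also have "\<dots> = (\<Sum>i\<in>I. \<Sum>j\<in>I. \<Sum>a\<in>UNIV. \<Sum>b\<in>UNIV. (v i $ a * v j $ a) * (v i $ b * v j $ b))"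
    by (rule sum.cong[OF refl], rule sum.swap)
  also have "\<dots> = (\<Sum>i\<in>I. \<Sum>j\<in>I. (v i \<bullet> v j)\<^sup>2)"
    by (simp add: inner_vec_def power2_eq_square sum_product)
  finally show ?thesis by (simp add: mult_left_mono)
qed

lemma plane_orthonormal_frame:
  assumes "plane \<Gamma>"
  obtains a :: "2 \<Rightarrow> 'a::euclidean_space"
  where "\<And>i j. a i \<bullet> a j = (if i = j then 1 else 0)" "span (range a) = \<Gamma>"
proof -
  obtain B where B: "pairwise orthogonal B" "\<And>x. x \<in> B \<Longrightarrow> norm x = 1"
      "card B = dim \<Gamma>" "span B = \<Gamma>"
    using orthonormal_basis_subspace assms unfolding plane_def by metis
  then obtain x y where xy: "B = {x, y}" "x \<noteq> y"
    using assms by (auto simp: plane_def card_2_iff)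
  define a where "a = (\<lambda>i::2. if i = 1 then x else y)"
  have "a i \<bullet> a j = (if i = j then 1 else 0)" for i j
    using exhaust_2[of i] exhaust_2[of j] B(1,2) xy
    by (auto simp: a_def pairwise_def orthogonal_def norm_eq_1)
  moreover have "span (range a) = \<Gamma>"
    using B(4) by (simp add: UNIV_2 a_def xy insert_commute)
  ultimately show ?thesis by (rule that)
qed

lemma equi_isoclinic_relative_bound:
  fixes \<Gamma> :: "nat \<Rightarrow> (real ^ 'n) set"
  assumes "equi_isoclinic l n \<Gamma>"
  shows "2 * real n \<le> real CARD('n) * (1 + (real n - 1) * l)"
proof (cases "n = 0")
  \<comment> \<open>The main case ends by dividing by 2n. For n = 0 the claim is 0 \<le> r (1 - l),
    which follows from l being a squared cosine.\<close>
  case True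
  from assms obtain \<phi> where "l = (cos \<phi>)\<^sup>2" by (auto simp: equi_isoclinic_def)
  then show ?thesis using True abs_cos_le_one[of \<phi>] by (simp add: abs_square_le_1)
next
  case False
  from assms obtain \<phi> where \<phi>: "\<phi> \<in> {0<..pi/2}" "l = (cos \<phi>)\<^sup>2"
    and pl: "\<And>i. i < n \<Longrightarrow> plane (\<Gamma> i)"
    and iso: "\<And>i j. i < n \<Longrightarrow> j < n \<Longrightarrow> i \<noteq> j \<Longrightarrow> isoclinic \<phi> (\<Gamma> i) (\<Gamma> j)"
    by (auto simp: equi_isoclinic_def)
  have "\<exists>a :: 2 \<Rightarrow> real ^ 'n. (\<forall>s t. a s \<bullet> a t = (if s = t then 1 else 0)) \<and> span (range a) = \<Gamma> i"
    if "i < n" for i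
    using plane_orthonormal_frame[OF pl[OF that]] by metis
  then obtain a :: "nat \<Rightarrow> 2 \<Rightarrow> real ^ 'n"
    where a: "\<And>i s t. i < n \<Longrightarrow> a i s \<bullet> a i t = (if s = t then 1 else 0)"
      and span: "\<And>i. i < n \<Longrightarrow> span (range (a i)) = \<Gamma> i"
    by metis
  \<comment> \<open>The sum is the trace of A A^T for the matrix A of inner products, and A A^T is l
    times the identity for distinct planes.\<close>
  have cross: "(\<Sum>s\<in>UNIV. \<Sum>t\<in>UNIV. (a i s \<bullet> a j t)\<^sup>2) = (if i = j then 2 else 2 * l)"
    if "i < n" "j < n" for i j
  proof (cases "i = j")
    case True
    then show ?thesis using that by (simp add: a sum_2)
  next
    case False
    let ?A = "(\<chi> s t. a i s \<bullet> a j t) :: real ^ 2 ^ 2"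
    have "?A ** transpose ?A = l *\<^sub>R mat 1"
      using isoclinic_iff_matrix[OF a[OF that(1)] span[OF that(1)] a[OF that(2)] span[OF that(2)], of \<phi>]
        iso[OF that False] \<phi> by simp
    then show ?thesis using False
      by (auto simp: vec_eq_iff matrix_matrix_mult_def transpose_def mat_def sum_2 forall_2
          power2_eq_square)
  qed
  let ?I = "{..<n} \<times> (UNIV :: 2 set)"
  have "(\<Sum>p\<in>?I. a (fst p) (snd p) \<bullet> a (fst p) (snd p)) = 2 * real n"
    by (simp add: a sum_2 sum.cartesian_product')
  moreover have "(\<Sum>p\<in>?I. \<Sum>p'\<in>?I. (a (fst p) (snd p) \<bullet> a (fst p') (snd p'))\<^sup>2) =
      2 * real n * (1 + (real n - 1) * l)"
  proof -
    have "(\<Sum>p\<in>?I. \<Sum>p'\<in>?I. (a (fst p) (snd p) \<bullet> a (fst p') (snd p'))\<^sup>2) =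
        (\<Sum>i<n. \<Sum>j<n. \<Sum>s\<in>UNIV. \<Sum>t\<in>UNIV. (a i s \<bullet> a j t)\<^sup>2)"
      unfolding sum.cartesian_product' fst_conv snd_conv
      by (rule sum.cong[OF refl], rule sum.swap)
    also have "\<dots> = (\<Sum>i<n. \<Sum>j<n. 2 * l + (if i = j then 2 - 2 * l else 0))"
      by (intro sum.cong refl) (simp add: cross)
    also have "\<dots> = 2 * real n * (1 + (real n - 1) * l)"
      by (simp add: sum.distrib) (simp add: algebra_simps)
    finally show ?thesis .
  qed
  ultimately have "(2 * real n)\<^sup>2 \<le> real CARD('n) * (2 * real n * (1 + (real n - 1) * l))"
    using welch_bound[of "\<lambda>p. a (fst p) (snd p)" ?I] by simp
  then have "(2 * real n) * (2 * real n) \<le> (2 * real n) * (real CARD('n) * (1 + (real n - 1) * l))"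
    by (simp add: power2_eq_square mult_ac)
  then show ?thesis using False by (simp only: mult_le_cancel_left_pos)
qed

section \<open>Lower bound: planes from a conference matrix\<close>

text \<open>Carries the matrix criterion back to angles, with arccos (sqrt l) as the angle: a
  non-negative square root keeps it at most pi/2, and \<open>l < 1\<close> makes it
  non-zero.\<close>

lemma equi_isoclinicI:
  fixes a :: "nat \<Rightarrow> 2 \<Rightarrow> 'a::euclidean_space"
  assumes orth: "\<And>i s t. i < n \<Longrightarrow> a i s \<bullet> a i t = (if s = t then 1 else 0)"
    and l: "0 \<le> l" "l < 1"
    and cross: "\<And>i j. i < n \<Longrightarrow> j < n \<Longrightarrow> i \<noteq> j \<Longrightarrow>
      (\<chi> s t. a i s \<bullet> a j t) ** transpose (\<chi> s t. a i s \<bullet> a j t) = (l *\<^sub>R mat 1 :: real ^ 2 ^ 2)"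
  shows "equi_isoclinic l n (\<lambda>i. span (range (a i)))"
proof -
  define \<phi> where "\<phi> = arccos (sqrt l)"
  have cos: "cos \<phi> = sqrt l"
    unfolding \<phi>_def using l by (intro cos_arccos) (auto intro: order_trans[of _ 0])
  have \<phi>: "\<phi> \<in> {0<..pi/2}"
  proof -
    have "\<phi> \<noteq> 0" using cos l by auto
    moreover have "0 \<le> \<phi>" "\<phi> \<le> pi / 2"
      unfolding \<phi>_def using arccos_le_pi2[of "sqrt l"] arccos_lbound[of "sqrt l"] l
        real_sqrt_ge_zero[OF l(1)] by auto
    ultimately show ?thesis by simp
  qed
  have l_eq: "l = (cos \<phi>)\<^sup>2" using cos l by simp
  have "plane (span (range (a i)))" if "i < n" for i
  proof -
    have "a i 1 \<noteq> a i 2" using orth[OF that, of 1 1] orth[OF that, of 1 2] by auto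
    moreover have "a i s \<noteq> 0" for s using orth[OF that, of s s] by auto
    then have "independent (range (a i))"
      by (intro pairwise_orthogonal_independent)
         (auto simp: pairwise_def orthogonal_def orth[OF that])
    ultimately show ?thesis
      by (simp add: plane_def dim_eq_card_independent UNIV_2)
  qed
  moreover have "isoclinic \<phi> (span (range (a i))) (span (range (a j)))"
    if "i < n" "j < n" "i \<noteq> j" for i j
    using isoclinic_iff_matrix[OF orth[OF that(1)] refl orth[OF that(2)] refl, of \<phi>] cross[OF that]
      \<phi> l_eq by auto
  ultimately show ?thesis
    unfolding equi_isoclinic_def using \<phi> l_eq by blast
qed

lemma complex_symmetric_conference_matrix:
  fixes Q :: "'n::finite \<Rightarrow> 'n \<Rightarrow> real"
  assumes Q: "\<And>i. Q i i = 0" "\<And>i j. i \<noteq> j \<Longrightarrow> (Q i j)\<^sup>2 = 1"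
    "\<And>i j. Q i j = Q j i" "\<And>i. (\<Sum>j\<in>UNIV. Q i j) = 0"
    "\<And>i j. i \<noteq> j \<Longrightarrow> (\<Sum>k\<in>UNIV. Q i k * Q j k) = - 1"
    and card: "CARD('n) \<ge> 2"
  obtains D :: "'n \<Rightarrow> 'n \<Rightarrow> complex" where
    "\<And>i. D i i = 0" "\<And>i j. D i j = D j i" "\<And>i j. i \<noteq> j \<Longrightarrow> cmod (D i j) = 1"
    "\<And>i j. (\<Sum>k\<in>UNIV. D i k * cnj (D j k)) = (if i = j then of_nat CARD('n) - 1 else 0)"
proof -
  define q where "q = real CARD('n)"
  have q: "q \<ge> 2" using card by (simp add: q_def)
  \<comment> \<open>The constants solve a^2 + b^2 = 1, for unimodular entries, and (q - 2) a^2 =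
    b^2, for orthogonal rows.\<close>
  define a where "a = sqrt (1 / (q - 1))"
  define b where "b = sqrt ((q - 2) / (q - 1))"
  have a2: "a * a = 1 / (q - 1)" and b2: "b * b = (q - 2) / (q - 1)"
    using q by (simp_all add: a_def b_def)
  have ab: "a * a + b * b = 1" using q by (simp add: a2 b2 field_simps)
  define D where "D i j = (if i = j then 0 else Complex a (b * Q i j))" for i j
  have "cmod (D i j) = 1" if "i \<noteq> j" for i j
    using that ab Q(2)[OF that] by (simp add: D_def cmod_def power_mult_distrib) (simp add: power2_eq_square)
  moreover have "(\<Sum>k\<in>UNIV. D i k * cnj (D j k)) = (if i = j then of_nat CARD('n) - 1 else 0)" for i j
  proof (cases "i = j")
    case True
    have "(\<Sum>k\<in>UNIV. D i k * cnj (D i k)) = (\<Sum>k\<in>UNIV. 1 - (if k = i then 1 else 0))"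
      using \<open>\<And>i j. i \<noteq> j \<Longrightarrow> cmod (D i j) = 1\<close>
      by (intro sum.cong refl) (auto simp: D_def simp flip: complex_norm_square)
    also have "\<dots> = of_nat CARD('n) - 1"
      by (simp add: sum_subtractf)
    finally show ?thesis using True by simp
  next
    case False
    \<comment> \<open>The first term is the product for k different from i and j; the other two
      remove its values at k = i and k = j, where \<open>D\<close> has a zero factor. Their
      imaginary parts cancel because \<open>Q\<close> is symmetric.\<close>
    have "D i k * cnj (D j k) =
        Complex (a * a + b * b * (Q i k * Q j k)) (a * b * (Q i k - Q j k)) -
        (if k = i then Complex (a * a) (- a * b * Q i j) else 0) -
        (if k = j then Complex (a * a) (a * b * Q i j) else 0)" for k
      using False Q(1) by (auto simp: D_def complex_eq_iff algebra_simps Q(3)[of j i])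
    then have "(\<Sum>k\<in>UNIV. D i k * cnj (D j k)) =
        (\<Sum>k\<in>UNIV. Complex (a * a + b * b * (Q i k * Q j k)) (a * b * (Q i k - Q j k))) -
        Complex (a * a) (- a * b * Q i j) - Complex (a * a) (a * b * Q i j)"
      by (simp add: sum_subtractf)
    also have "(\<Sum>k\<in>UNIV. Complex (a * a + b * b * (Q i k * Q j k)) (a * b * (Q i k - Q j k))) =
        Complex (q * (a * a) - b * b) 0"
      by (simp add: complex_eq_iff sum.distrib sum_subtractf Q(4) Q(5)[OF False] q_def
          flip: sum_distrib_left)
    also have "b * b = (q - 2) * (a * a)"
      by (simp add: a2 b2)
    also have "Complex (q * (a * a) - (q - 2) * (a * a)) 0 -
        Complex (a * a) (- a * b * Q i j) - Complex (a * a) (a * b * Q i j) = 0"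
      by (simp add: complex_eq_iff algebra_simps)
    finally show ?thesis using False by simp
  qed
  ultimately show ?thesis
    using Q(3) by (intro that[of D]) (auto simp: D_def)
qed

text \<open>Multiplication by \<open>\<i>\<close> exchanges the eigenspaces for \<open>1\<close> and \<open>-1\<close>.\<close>

lemma dim_eigenspace_antilinear_involution:
  fixes J :: "complex ^ 'n \<Rightarrow> complex ^ 'n"
  assumes lin: "linear J" and inv: "\<And>z. J (J z) = z" and anti: "\<And>z. J (\<i> *s z) = - (\<i> *s J z)"
  shows "dim {z. J z = z} = CARD('n)"
proof -
  let ?E = "{z. J z = z}" and ?E' = "{z. J z = - z}"
  have sub: "subspace ?E" "subspace ?E'"
    by (auto simp: subspace_def linear_0[OF lin] linear_add[OF lin] linear_scale[OF lin])
  have i_lin: "linear ((*s) \<i> :: complex ^ 'n \<Rightarrow> _)"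
    by (rule linearI) (simp_all add: vec_eq_iff algebra_simps)
  have ii: "\<i> *s (\<i> *s z) = - z" for z :: "complex ^ 'n"
    by (simp add: vec_eq_iff)
  have "?E' = (*s) \<i> ` ?E"
  proof (intro subset_antisym subsetI)
    fix z assume "z \<in> ?E'"
    then have "J (\<i> *s (- z)) = \<i> *s (- z)" "z = \<i> *s (\<i> *s (- z))"
      by (simp_all add: anti ii linear_neg[OF lin])
    then show "z \<in> (*s) \<i> ` ?E" by blast
  qed (auto simp: anti)
  moreover have "inj ((*s) \<i> :: complex ^ 'n \<Rightarrow> _)"
    by (rule injI) (simp add: vec_eq_iff)
  ultimately have "dim ?E' = dim ?E"
    using dim_image_eq[OF i_lin] by (metis inj_on_subset subset_UNIV)
  moreover have "{x + y |x y. x \<in> ?E \<and> y \<in> ?E'} = UNIV"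
  proof -
    have "\<exists>x y. z = x + y \<and> x \<in> ?E \<and> y \<in> ?E'" for z
      by (rule exI[of _ "(1/2) *\<^sub>R (z + J z)"], rule exI[of _ "(1/2) *\<^sub>R (z - J z)"])
         (simp add: linear_scale[OF lin] linear_add[OF lin] linear_diff[OF lin] inv
           scaleR_add_right scaleR_diff_right add.commute flip: scaleR_add_left)
    then show ?thesis by blast
  qed
  moreover have "?E \<inter> ?E' = {0}"
  proof -
    have "z = 0" if "J z = z" "J z = - z" for z
    proof -
      have "2 *\<^sub>R z = 0" using that by (simp add: scaleR_2 eq_neg_iff_add_eq_0)
      then show ?thesis by simp
    qed
    then show ?thesis by (auto simp: linear_0[OF lin])
  qed
  \<comment> \<open>Dimensions are real, so the whole space contributes 2
    \<open>CARD('n)\<close>.\<close>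
  ultimately have "2 * dim ?E = 2 * CARD('n)"
    using dim_sums_Int[OF sub] by simp
  then show ?thesis by simp
qed

lemma planes_of_complex_symmetric_conference_matrix:
  fixes D :: "'n::finite \<Rightarrow> 'n \<Rightarrow> complex"
  assumes D: "\<And>i. D i i = 0" "\<And>i j. D i j = D j i" "\<And>i j. i \<noteq> j \<Longrightarrow> cmod (D i j) = 1"
    "\<And>i j. (\<Sum>k\<in>UNIV. D i k * cnj (D j k)) = (if i = j then of_nat CARD('n) - 1 else 0)"
    and card: "CARD('n) > 2"
  shows "\<exists>\<Gamma> :: nat \<Rightarrow> (real ^ 'n) set. equi_isoclinic (1 / (real CARD('n) - 1)) CARD('n) \<Gamma>"
proof -
  define c where "c = 1 / sqrt (real CARD('n) - 1)"
  have c2: "c * c = 1 / (real CARD('n) - 1)"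
    using card by (simp add: c_def)
  define J :: "complex ^ 'n \<Rightarrow> complex ^ 'n"
    where "J z = (\<chi> i. of_real c * (\<Sum>j\<in>UNIV. D i j * cnj (z $ j)))" for z
  have J_lin: "linear J"
    by (rule linearI) (simp_all add: J_def vec_eq_iff distrib_left sum.distrib flip: scaleR_sum_right)
  have J_anti: "J (\<i> *s z) = - (\<i> *s J z)" for z
    by (simp add: J_def vec_eq_iff sum_distrib_left sum_negf algebra_simps)
  \<comment> \<open>Conjugation makes the square of \<open>J\<close> equal to c^2 D conj(D), which
    for symmetric \<open>D\<close> is c^2 D D* = I.\<close>
  have J_inv: "J (J z) = z" for z
  proof -
    have "J (J z) $ i = z $ i" for i
    proof -
      have "J (J z) $ i = (\<Sum>j\<in>UNIV. \<Sum>k\<in>UNIV. of_real (c * c) * z $ k * (D i j * cnj (D k j)))"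
        by (simp add: J_def sum_distrib_left D(2) mult_ac)
      also have "\<dots> = (\<Sum>k\<in>UNIV. of_real (c * c) * z $ k * (\<Sum>j\<in>UNIV. D i j * cnj (D k j)))"
        by (subst sum.swap) (simp only: sum_distrib_left)
      also have "\<dots> = of_real (c * c) * z $ i * of_real (real CARD('n) - 1)"
        unfolding D(4) by (simp add: if_distrib cong: if_cong)
      also have "\<dots> = of_real (c * c * (real CARD('n) - 1)) * z $ i"
        by simp
      also have "c * c * (real CARD('n) - 1) = 1"
        unfolding c2 using card by simp
      finally show ?thesis by simp
    qed
    then show ?thesis by (simp add: vec_eq_iff)
  qed
  \<comment> \<open>Symmetry of \<open>D\<close> makes \<open>J\<close> self-adjoint for the real
    inner product, so (I + J)/2 is the orthogonal projection onto the fixed space.\<close>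
  have J_sym: "J z \<bullet> w = z \<bullet> J w" for z w
  proof -
    have "J z \<bullet> w = (\<Sum>i\<in>UNIV. \<Sum>j\<in>UNIV. c * Re (D i j * cnj (z $ j) * cnj (w $ i)))"
      by (simp add: J_def inner_vec_def inner_complex_def sum_distrib_left sum_distrib_right algebra_simps
          sum.distrib sum_subtractf sum_negf)
    also have "\<dots> = (\<Sum>i\<in>UNIV. \<Sum>j\<in>UNIV. c * Re (D i j * cnj (w $ j) * cnj (z $ i)))"
      by (subst sum.swap) (simp add: D(2) mult_ac)
    also have "\<dots> = J w \<bullet> z"
      by (simp add: J_def inner_vec_def inner_complex_def sum_distrib_left sum_distrib_right algebra_simps
          sum.distrib sum_subtractf sum_negf)
    finally show ?thesis by (simp add: inner_commute)
  qed
  let ?E = "{z. J z = z}"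
  have "subspace ?E"
    by (auto simp: subspace_def linear_0[OF J_lin] linear_add[OF J_lin] linear_scale[OF J_lin])
  moreover have "dim ?E = dim (UNIV :: (real ^ 'n) set)"
    by (simp add: dim_eigenspace_antilinear_involution J_lin J_inv J_anti)
  \<comment> \<open>Equal dimensions give an isometry from the fixed space to the target space;
    polarization upgrades preserved norms to preserved inner products.\<close>
  ultimately obtain f :: "complex ^ 'n \<Rightarrow> real ^ 'n"
    where f: "linear f" "\<And>z. z \<in> ?E \<Longrightarrow> norm (f z) = norm z"
    by (rule isometry_subspaces[OF _ subspace_UNIV]) (rule that)
  have f_inner: "f x \<bullet> f y = x \<bullet> y" if "x \<in> ?E" "y \<in> ?E" for x y
    using that f(2)[of "x + y"] f(2)[of x] f(2)[of y] linear_add[OF J_lin]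
    by (simp add: dot_norm flip: linear_add[OF f(1)])
  define u :: "2 \<Rightarrow> complex" where "u s = (if s = 1 then 1 else \<i>)" for s
  \<comment> \<open>This is sqrt 2 times the projection of \<open>axis j (u s)\<close>. The factor
    gives unit length, because the zero diagonal of \<open>D\<close> makes
    \<open>axis j (u s)\<close> orthogonal to its image under \<open>J\<close>.\<close>
  define w where "w j s = (1 / sqrt 2) *\<^sub>R (axis j (u s) + J (axis j (u s)))" for j s
  have wE: "w j s \<in> ?E" for j s
    by (simp add: w_def linear_add[OF J_lin] linear_scale[OF J_lin] J_inv add.commute)
  have w_inner: "w j s \<bullet> w k t = (if j = k then u s \<bullet> u t else 0) + c * (u s \<bullet> (D j k * cnj (u t)))"
    for j k s t
  proof -
    let ?x = "axis j (u s) :: complex ^ 'n" and ?y = "axis k (u t) :: complex ^ 'n"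
    have "w j s \<bullet> w k t = (1 / 2) * ((?x + J ?x) \<bullet> (?y + J ?y))"
      by (simp add: w_def)
    also have "(?x + J ?x) \<bullet> (?y + J ?y) = 2 * (?x \<bullet> ?y + ?x \<bullet> J ?y)"
      by (simp add: inner_add_left inner_add_right J_sym J_inv)
    also have "?x \<bullet> ?y = (if j = k then u s \<bullet> u t else 0)"
      by (simp add: inner_axis_axis)
    also have "J ?y $ j = of_real c * (D j k * cnj (u t))"
      by (simp add: J_def axis_def if_distrib cong: if_cong)
    then have "?x \<bullet> J ?y = c * (u s \<bullet> (D j k * cnj (u t)))"
      by (simp add: inner_axis' inner_complex_def algebra_simps)
    finally show ?thesis by simp
  qed
  obtain e :: "nat \<Rightarrow> 'n" where e: "bij_betw e {..<CARD('n)} UNIV"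
    using finite_same_card_bij[of "{..<CARD('n)}" "UNIV :: 'n set"] by auto
  define a where "a i s = f (w (e i) s)" for i s
  have u: "u s \<bullet> u t = (if s = t then 1 else 0)" for s t
    using exhaust_2[of s] exhaust_2[of t] by (auto simp: u_def inner_complex_def)
  have "equi_isoclinic (1 / (real CARD('n) - 1)) CARD('n) (\<lambda>i. span (range (a i)))"
  proof (rule equi_isoclinicI)
    show "a i s \<bullet> a i t = (if s = t then 1 else 0)" for i s t
      by (simp add: a_def f_inner[OF wE wE] w_inner u D(1))
    show "(\<chi> s t. a i s \<bullet> a j t) ** transpose (\<chi> s t. a i s \<bullet> a j t) =
        ((1 / (real CARD('n) - 1)) *\<^sub>R mat 1 :: real ^ 2 ^ 2)"
      if "i < CARD('n)" "j < CARD('n)" "i \<noteq> j" for i j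
    proof -
      have ne: "e i \<noteq> e j"
        using e that by (auto simp: bij_betw_def inj_on_def)
      define d where "d = D (e i) (e j)"
      have "Re d * Re d + Im d * Im d = 1"
        using D(3)[OF ne] by (simp add: d_def[symmetric] cmod_def power2_eq_square)
      then have d: "c * Re d * (c * Re d) + c * Im d * (c * Im d) = c * c"
        by (metis (no_types) distrib_left mult.assoc mult.left_commute mult.right_neutral)
      have *: "a i s \<bullet> a j t = c * (u s \<bullet> (d * cnj (u t)))" for s t
        using ne by (simp add: a_def f_inner[OF wE wE] w_inner d_def)
      \<comment> \<open>The inner products form c times a plane reflection matrix, orthogonal
        because d is unimodular; hence A A^T = c^2 I.\<close>
      have "a i 1 \<bullet> a j 1 = c * Re d" "a i 1 \<bullet> a j 2 = c * Im d"
        "a i 2 \<bullet> a j 1 = c * Im d" "a i 2 \<bullet> a j 2 = - (c * Re d)"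
        unfolding * by (simp_all add: u_def inner_complex_def)
      then show ?thesis
        using d unfolding c2[symmetric]
        by (simp add: vec_eq_iff matrix_matrix_mult_def transpose_def mat_def sum_2 forall_2
            add.commute)
    qed
  qed (use card in auto)
  then show ?thesis by blast
qed

section \<open>Equality of the two bounds\<close>

theorem corollary8:
  fixes k p \<alpha> :: nat
  assumes "k \<ge> 3"
    and "prime p" and "odd p"
    and "2 * k = p ^ \<alpha> + 1"
    and "(2 * k) mod 4 = 2"
    and "CARD('n::finite) = 2 * k - 1"
  shows "max_equi_isoclinic (1 / (2 * real k - 2)) TYPE(real ^ 'n) = enat (2 * k - 1)"
proof -
  define q where "q = CARD('n)"
  have "2 * k = q + 1" "q > 2"
    using assms unfolding q_def by auto
  then have q: "q > 2" "2 * real k - 2 = real q - 1" "2 * k - 1 = q"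
    by linarith+
  have card: "CARD('n) = p ^ \<alpha>" "CARD('n) > 1" "CARD('n) \<ge> 2"
    using assms(4,6) \<open>q > 2\<close> by (auto simp: q_def)
  have mod4: "CARD('n) mod 4 = 1"
    using assms(5) \<open>2 * k = q + 1\<close> unfolding q_def by presburger
  obtain Q :: "'n \<Rightarrow> 'n \<Rightarrow> real" where Q: "\<And>i. Q i i = 0" "\<And>i j. i \<noteq> j \<Longrightarrow> (Q i j)\<^sup>2 = 1"
      "\<And>i j. Q i j = Q j i" "\<And>i. (\<Sum>j\<in>UNIV. Q i j) = 0"
      "\<And>i j. i \<noteq> j \<Longrightarrow> (\<Sum>k\<in>UNIV. Q i k * Q j k) = - 1"
    by (rule paley_core[OF assms(2) card(1) mod4 card(2)]) (rule that)
  obtain D :: "'n \<Rightarrow> 'n \<Rightarrow> complex" where D: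
      "\<And>i. D i i = 0" "\<And>i j. D i j = D j i" "\<And>i j. i \<noteq> j \<Longrightarrow> cmod (D i j) = 1"
      "\<And>i j. (\<Sum>k\<in>UNIV. D i k * cnj (D j k)) = (if i = j then of_nat CARD('n) - 1 else 0)"
    using complex_symmetric_conference_matrix[of Q, OF Q card(3)] by blast
  have ex: "\<exists>\<Gamma> :: nat \<Rightarrow> (real ^ 'n) set. equi_isoclinic (1 / (real q - 1)) q \<Gamma>"
    unfolding q_def
    by (rule planes_of_complex_symmetric_conference_matrix[of D]) (fact D q(1)[unfolded q_def])+
  have bound: "n \<le> q" if "equi_isoclinic (1 / (real q - 1)) n \<Gamma>"
    for n and \<Gamma> :: "nat \<Rightarrow> (real ^ 'n) set"
  proof -
    have "2 * real n \<le> real q * (1 + (real n - 1) * (1 / (real q - 1)))"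
      using equi_isoclinic_relative_bound[OF that] by (simp add: q_def)
    then have "2 * real n * (real q - 1) \<le> real q * (real q + real n - 2)"
      using q by (simp add: field_simps)
    \<comment> \<open>Collecting the terms in n leaves the factor q - 2 on both sides; it is
      positive and cancels.\<close>
    then have "(real q - 2) * real n \<le> (real q - 2) * real q"
      by (simp add: algebra_simps)
    then show ?thesis using q by simp
  qed
  show ?thesis
    unfolding max_equi_isoclinic_def q
    by (intro antisym SUP_least SUP_upper) (use ex bound in auto)
qed

end
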